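(* Let $L$ be a locally compact topological loop and let $\mu$ be a Radon measure on $L$. Assume that $\mu$ is left quasi-invariant, with left modular cocycle $\lambda(a,x)=\frac{d(L_a)_*\mu}{d\mu}(x)$, and that it is also quasi-invariant under each associativity deviation homeomorphism $\Phi_{a,b}=L_a\circ L_b\circ L_{ab}^{-1}$ $(a,b\in L)$, with Radon--Nikodym derivative $J_\Phi(a,b;x)=\frac{d(\Phi_{a,b})_*\mu}{d\mu}(x)$. Then, for all $a,b\in L$ and for $\mu$-almost every $x\in L$, $$\lambda(a,x)\,\lambda\bigl(b,L_a^{-1}x\bigr)=J_\Phi(a,b;x)\,\lambda\bigl(ab,\Phi_{a,b}^{-1}x\bigr).$$ Equivalently, after replacing $x$ by $\Phi_{a,b}(x)$, $$\lambda\bigl(a,\Phi_{a,b}(x)\bigr)\,\lambda\bigl(b,L_a^{-1}\Phi_{a,b}(x)\bigr)=J_\Phi\bigl(a,b;\Phi_{a,b}(x)\bigr)\,\lambda(ab,x).$$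
   Context: A loop is a set $L$ with a binary operation $(x,y)\mapsto xy$ and an element $e\in L$ with $ex=xe=x$ for all $x\in L$, such that for all $a,b\in L$ the equations $ax=b$ and $ya=b$ have unique solutions. A topological loop is a loop with a Hausdorff topology for which multiplication and the left and right division operations are continuous. For $a\in L$ the left translation is $L_a:L\to L$, $L_a(x)=ax$; it is a homeomorphism of $L$, with inverse map $L_a^{-1}$. For $a,b\in L$ the associativity deviation homeomorphism $\Phi_{a,b}:L\to L$ is defined by $L_a\circ L_b=\Phi_{a,b}\circ L_{ab}$, i.e. $\Phi_{a,b}=L_a\circ L_b\circ L_{ab}^{-1}$. For a homeomorphism $f:L\to L$, $f_*\mu$ denotes the pushforward measure $f_*\mu(E)=\mu(f^{-1}(E))$. The measure $\mu$ is left quasi-invariant if $(L_a)_*\mu\ll\mu$ for every $a\in L$; the source states this as equivalent to the existence, for each $a\in L$, of a positive measurable function $\lambda(a,\cdot):L\to\mathbb{R}_{>0}$ with $\frac{d(L_a)_*\mu}{d\mu}(x)=\lambda(a,x)$ for $\mu$-almost every $x\in L$. The function $\lambda$ is the left modular cocycle of $\mu$. Quasi-invariance of $\mu$ under $\Phi_{a,b}$ is meant in the same sense, for the pushforward $(\Phi_{a,b})_*\mu$, and $J_\Phi(a,b;\cdot)$ is the corresponding Radon--Nikodym derivative. *)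

theory Defs
  imports "HOL-Analysis.Analysis"
begin

locale loop =
  fixes m :: "'a \<Rightarrow> 'a \<Rightarrow> 'a" and e :: 'a
  assumes left_neutral: "m e x = x"
    and right_neutral: "m x e = x"
    and left_division: "\<exists>!x. m a x = b"
    and right_division: "\<exists>!y. m y a = b"

definition left_div :: "('a \<Rightarrow> 'a \<Rightarrow> 'a) \<Rightarrow> 'a \<Rightarrow> 'a \<Rightarrow> 'a" where
  "left_div m a b = (THE x. m a x = b)"

definition right_div :: "('a \<Rightarrow> 'a \<Rightarrow> 'a) \<Rightarrow> 'a \<Rightarrow> 'a \<Rightarrow> 'a" where
  "right_div m b a = (THE y. m y a = b)"

locale topological_loop = loop m e
  for m :: "'a::t2_space \<Rightarrow> 'a \<Rightarrow> 'a" and e :: 'a +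
  assumes continuous_mult: "continuous_on UNIV (\<lambda>(x, y). m x y)"
    and continuous_left_div: "continuous_on UNIV (\<lambda>(a, b). left_div m a b)"
    and continuous_right_div: "continuous_on UNIV (\<lambda>(b, a). right_div m b a)"

definition left_translation :: "('a \<Rightarrow> 'a \<Rightarrow> 'a) \<Rightarrow> 'a \<Rightarrow> 'a \<Rightarrow> 'a" where
  "left_translation m a = (\<lambda>x. m a x)"

definition assoc_deviation :: "('a \<Rightarrow> 'a \<Rightarrow> 'a) \<Rightarrow> 'a \<Rightarrow> 'a \<Rightarrow> 'a \<Rightarrow> 'a" where
  "assoc_deviation m a b =
    left_translation m a \<circ> left_translation m b \<circ> inv (left_translation m (m a b))"

(* A Borel measure that is locally finite and inner regular by compact sets on all Borel
   sets. Without sigma-finiteness this differs from the convention "outer regular on Borel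
   sets, inner regular on open sets", for which Radon-Nikodym densities are determined only
   locally almost everywhere. *)
definition radon_measure :: "'a::t2_space measure \<Rightarrow> bool" where
  "radon_measure M \<longleftrightarrow>
    sets M = sets borel \<and>
    (\<forall>x. \<exists>U. open U \<and> x \<in> U \<and> emeasure M U < \<infinity>) \<and>
    (\<forall>E \<in> sets borel. emeasure M E = (SUP K \<in> {K. compact K \<and> K \<subseteq> E}. emeasure M K))"

definition quasi_invariant :: "'a::topological_space measure \<Rightarrow> ('a \<Rightarrow> 'a) \<Rightarrow> bool" where
  "quasi_invariant M f \<longleftrightarrow> absolutely_continuous M (distr M borel f)"

(* g is a version of the derivative d(f_* M)/dM. The measure M need not be sigma-finite, so
   the existence of g is not implied by absolute continuity. *)
definition pushforward_derivative ::
    "'a::topological_space measure \<Rightarrow> ('a \<Rightarrow> 'a) \<Rightarrow> ('a \<Rightarrow> real) \<Rightarrow> bool" where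
  "pushforward_derivative M f g \<longleftrightarrow>
    g \<in> borel_measurable M \<and> (\<forall>x. 0 < g x) \<and> density M (\<lambda>x. ennreal (g x)) = distr M borel f"

end

theory Submission
  imports Defs
begin

text \<open>
  The identity is the chain rule for Radon--Nikodym derivatives applied to one homeomorphism written
  in two ways. By definition of the deviation, \<open>L\<^sub>a \<circ> L\<^sub>b = \<Phi>\<^sub>a\<^sub>b \<circ> L\<^sub>a\<^sub>b\<close>. If \<open>p\<close> and \<open>q\<close> are
  derivatives for homeomorphisms \<open>f\<close> and \<open>g\<close>, then \<open>x \<mapsto> p x * q (f\<inverse> x)\<close> is one for \<open>f \<circ> g\<close>
  (\<open>pushforward_derivative_comp\<close>), so the left and right hand sides of the identity are both
  derivatives of the same pushforward. It remains to know that such derivatives agree almost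
  everywhere. The measure need not be \<open>\<sigma>\<close>-finite; instead, inner regularity reduces the question
  to compact sets, which have finite measure because the measure is locally finite
  (\<open>pushforward_derivative_unique\<close>). The second form of the identity follows from the first because
  \<open>\<Phi>\<^sub>a\<^sub>b\<close> pulls null sets back to null sets.
\<close>

section \<open>Densities with respect to a Radon measure\<close>

lemma radon_measure_compact_finite:
  assumes M: "radon_measure M" and K: "compact K"
  shows "emeasure M K < \<infinity>"
proof -
  have sets: "sets M = sets borel"
    using M by (simp add: radon_measure_def)
  have "\<forall>x. \<exists>U. open U \<and> x \<in> U \<and> emeasure M U < \<infinity>"
    using M by (simp add: radon_measure_def)
  then obtain U where U: "\<And>x. open (U x)" "\<And>x. x \<in> U x" "\<And>x. emeasure M (U x) < \<infinity>"
    by metis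
  obtain D where D: "finite D" "K \<subseteq> (\<Union>x\<in>D. U x)"
  proof (rule compactE_image[OF K])
    show "\<And>x. x \<in> UNIV \<Longrightarrow> open (U x)" by (rule U(1))
    show "K \<subseteq> (\<Union>x\<in>UNIV. U x)" using U(2) by blast
  qed
  have "emeasure M K \<le> emeasure M (\<Union>x\<in>D. U x)"
    using D U(1) by (intro emeasure_mono) (auto simp: sets)
  also have "\<dots> \<le> (\<Sum>x\<in>D. emeasure M (U x))"
    using D(1) U(1) by (intro emeasure_subadditive_finite) (auto simp: sets)
  also have "\<dots> < \<infinity>"
    using D(1) U(3) by simp
  finally show ?thesis .
qed

lemma radon_measure_null_setI:
  assumes M: "radon_measure M" and E: "E \<in> sets borel"
    and null: "\<And>K. compact K \<Longrightarrow> K \<subseteq> E \<Longrightarrow> emeasure M K = 0"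
  shows "E \<in> null_sets M"
proof -
  have sets: "sets M = sets borel"
    using M by (simp add: radon_measure_def)
  have "emeasure M E = (SUP K \<in> {K. compact K \<and> K \<subseteq> E}. emeasure M K)"
    using M E by (simp add: radon_measure_def)
  also have "\<dots> = 0"
  proof (rule antisym)
    show "(SUP K \<in> {K. compact K \<and> K \<subseteq> E}. emeasure M K) \<le> 0"
      by (rule SUP_least) (simp add: null)
  qed simp
  finally show ?thesis
    using E sets by (intro null_setsI) simp_all
qed

text \<open>
  Where \<open>g < h\<close>, the set is exhausted by the pieces on which \<open>g\<close> is bounded. On a compact subset of
  such a piece the integral of \<open>g\<close> is finite and equals that of \<open>h\<close>, so the strictly positive
  function \<open>h - g\<close> integrates to zero there and the compact set is null.
\<close>

lemma radon_density_eq_imp_AE_le: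
  fixes g h :: "'a::t2_space \<Rightarrow> real"
  assumes M: "radon_measure M"
    and [measurable]: "g \<in> borel_measurable M" "h \<in> borel_measurable M"
    and nonneg: "\<And>x. 0 \<le> g x" "\<And>x. 0 \<le> h x"
    and eq: "density M (\<lambda>x. ennreal (g x)) = density M (\<lambda>x. ennreal (h x))"
  shows "AE x in M. h x \<le> g x"
proof -
  have sets: "sets M = sets borel"
    using M by (simp add: radon_measure_def)
  have space: "space M = UNIV"
    using sets_eq_imp_space_eq[OF sets] by simp
  define E where "E n = {x \<in> space M. g x < h x \<and> g x \<le> real n}" for n :: nat
  have E_sets: "E n \<in> sets borel" for n
    unfolding E_def sets[symmetric] by measurable
  have "E n \<in> null_sets M" for n
  proof (rule radon_measure_null_setI[OF M E_sets])
    fix K assume K: "compact K" "K \<subseteq> E n"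
    have [measurable]: "K \<in> sets M"
      using K(1) by (simp add: sets borel_compact)
    have K_lt: "g x < h x" and K_le: "g x \<le> real n" if "x \<in> K" for x
      using K(2) that by (auto simp: E_def)
    have gK: "(\<integral>\<^sup>+x. ennreal (g x) * indicator K x \<partial>M) \<noteq> \<infinity>"
    proof -
      have "(\<integral>\<^sup>+x. ennreal (g x) * indicator K x \<partial>M) \<le> (\<integral>\<^sup>+x. ennreal (real n) * indicator K x \<partial>M)"
        using K_le by (intro nn_integral_mono) (simp add: ennreal_leI split: split_indicator)
      also have "\<dots> = ennreal (real n) * emeasure M K"
        by (simp add: nn_integral_cmult_indicator)
      also have "\<dots> < \<infinity>"
        using radon_measure_compact_finite[OF M K(1)] by (simp add: ennreal_mult_less_top)
      finally show ?thesis by simp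
    qed
    have gh: "ennreal (g x) * indicator K x \<le> ennreal (h x) * indicator K x" for x
      using less_imp_le[OF K_lt] by (cases "x \<in> K") (simp_all add: ennreal_leI)
    have "(\<integral>\<^sup>+x. ennreal (g x) * indicator K x \<partial>M) = (\<integral>\<^sup>+x. ennreal (h x) * indicator K x \<partial>M)"
      using arg_cong[OF eq, of "\<lambda>N. emeasure N K"] by (simp add: emeasure_density)
    then have "(\<integral>\<^sup>+x. (ennreal (h x) * indicator K x - ennreal (g x) * indicator K x) \<partial>M) = 0"
      using gK gh by (subst nn_integral_diff) (simp_all add: AE_I2)
    then have "AE x in M. ennreal (h x) * indicator K x - ennreal (g x) * indicator K x = 0"
      by (subst (asm) nn_integral_0_iff_AE) simp_all
    then have "AE x in M. x \<notin> K"
    proof eventually_elim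
      case (elim x)
      show "x \<notin> K"
      proof
        assume "x \<in> K"
        then have "g x < h x" by (rule K_lt)
        moreover have "ennreal (h x) - ennreal (g x) = 0"
          using elim \<open>x \<in> K\<close> by simp
        ultimately show False
          using nonneg[of x] by (simp add: ennreal_minus)
      qed
    qed
    then have "K \<in> null_sets M"
      by (subst AE_iff_null_sets) simp_all
    then show "emeasure M K = 0"
      by (rule null_setsD1)
  qed
  then have "AE x in M. \<forall>n. x \<notin> E n"
    unfolding AE_all_countable by (intro allI AE_not_in)
  then show ?thesis
  proof eventually_elim
    case (elim x)
    obtain n where "g x \<le> real n" using real_arch_simple by blast
    moreover have "x \<notin> E n" using elim by blast
    ultimately show ?case by (simp add: E_def space)
  qed
qed

lemma pushforward_derivative_unique:
  assumes M: "radon_measure M"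
    and g: "pushforward_derivative M f g" and h: "pushforward_derivative M f h"
  shows "AE x in M. g x = h x"
proof -
  have "AE x in M. h x \<le> g x" "AE x in M. g x \<le> h x"
    using g h unfolding pushforward_derivative_def
    by (auto intro!: radon_density_eq_imp_AE_le[OF M] less_imp_le)
  then show ?thesis by eventually_elim auto
qed

section \<open>Pushforwards under homeomorphisms\<close>

text \<open>
  Pushing the density \<open>q\<close> of \<open>g\<^sub>*M\<close> forward along \<open>f\<close> gives the density \<open>q \<circ> f\<inverse>\<close> with respect to
  \<open>f\<^sub>*M\<close>, which itself has density \<open>p\<close> with respect to \<open>M\<close>.
\<close>

lemma pushforward_derivative_comp:
  assumes sets: "sets M = sets borel"
    and f: "inj f" "f \<in> borel_measurable borel" "inv f \<in> borel_measurable borel"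
    and g: "g \<in> borel_measurable borel"
    and p: "pushforward_derivative M f p" and q: "pushforward_derivative M g q"
  shows "pushforward_derivative M (f \<circ> g) (\<lambda>x. p x * q (inv f x))"
proof -
  note [measurable] = f(2,3) g
  have [measurable]: "p \<in> borel_measurable borel" "q \<in> borel_measurable borel"
    using p q by (auto simp: pushforward_derivative_def measurable_cong_sets[OF sets refl])
  have pos: "0 < p x" "0 < q x" for x
    using p q by (auto simp: pushforward_derivative_def)
  have [measurable]: "f \<in> measurable M borel" "g \<in> measurable M borel" "p \<in> borel_measurable M"
    "(\<lambda>x. q (inv f x)) \<in> borel_measurable M"
    by (simp_all add: measurable_cong_sets[OF sets refl])
  have "distr M borel (f \<circ> g) = distr (distr M borel g) borel f"
    by (simp add: distr_distr)
  also have "\<dots> = distr (density M (\<lambda>x. ennreal (q x))) borel f"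
    using q by (simp add: pushforward_derivative_def)
  also have "\<dots> = distr (density M (\<lambda>x. ennreal (q (inv f (f x))))) borel f"
    using f(1) by simp
  also have "\<dots> = density (distr M borel f) (\<lambda>x. ennreal (q (inv f x)))"
    by (rule density_distr[symmetric]) measurable
  also have "\<dots> = density (density M (\<lambda>x. ennreal (p x))) (\<lambda>x. ennreal (q (inv f x)))"
    using p by (simp add: pushforward_derivative_def)
  also have "\<dots> = density M (\<lambda>x. ennreal (p x) * ennreal (q (inv f x)))"
    by (rule density_density_eq) measurable
  also have "\<dots> = density M (\<lambda>x. ennreal (p x * q (inv f x)))"
    using pos by (simp add: ennreal_mult less_imp_le)
  finally show ?thesis
    using pos by (auto simp: pushforward_derivative_def)
qed

lemma quasi_invariant_AE:
  assumes sets: "sets M = sets borel" and f: "f \<in> borel_measurable borel"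
    and qi: "quasi_invariant M f" and P: "AE x in M. P x"
  shows "AE x in M. P (f x)"
proof -
  have fM: "f \<in> measurable M borel"
    using f by (simp add: measurable_cong_sets[OF sets refl])
  have "AE x in distr M borel f. P x"
  proof (rule absolutely_continuous_AE)
    show "sets (distr M borel f) = sets M" using sets by simp
    show "absolutely_continuous M (distr M borel f)" using qi by (simp add: quasi_invariant_def)
  qed (fact P)
  then show ?thesis
    by (rule AE_distrD[OF fM])
qed

section \<open>Translations and deviations of a loop\<close>

lemma (in loop) bij_left_translation: "bij (left_translation m a)"
  using left_division by (auto simp: bij_iff left_translation_def)

lemma (in loop) inv_left_translation: "inv (left_translation m a) = left_div m a"
proof (rule inv_equality)
  fix x
  have "left_div m a (m a x) = x"
    unfolding left_div_def using left_division by (intro the1_equality) auto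
  then show "left_div m a (left_translation m a x) = x"
    by (simp add: left_translation_def)
  have "m a (left_div m a x) = x"
    unfolding left_div_def using left_division by (rule theI')
  then show "left_translation m a (left_div m a x) = x"
    by (simp add: left_translation_def)
qed

lemma (in topological_loop) continuous_left_translation:
  "continuous_on UNIV (left_translation m a)"
proof -
  have "continuous_on UNIV ((\<lambda>(x, y). m x y) \<circ> (\<lambda>x. (a, x)))"
    by (rule continuous_on_compose)
      (auto intro!: continuous_intros continuous_on_subset[OF continuous_mult])
  then show ?thesis by (simp add: left_translation_def comp_def)
qed

lemma (in topological_loop) continuous_inv_left_translation:
  "continuous_on UNIV (inv (left_translation m a))"
proof -
  have "continuous_on UNIV ((\<lambda>(x, y). left_div m x y) \<circ> (\<lambda>x. (a, x)))"
    by (rule continuous_on_compose)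
      (auto intro!: continuous_intros continuous_on_subset[OF continuous_left_div])
  then show ?thesis by (simp add: inv_left_translation comp_def)
qed

lemma (in loop) bij_assoc_deviation: "bij (assoc_deviation m a b)"
  unfolding assoc_deviation_def
  by (intro bij_comp bij_imp_bij_inv bij_left_translation)

lemma (in loop) inv_assoc_deviation:
  "inv (assoc_deviation m a b) =
    left_translation m (m a b) \<circ> inv (left_translation m b) \<circ> inv (left_translation m a)"
  by (simp add: assoc_deviation_def o_inv_distrib bij_comp bij_imp_bij_inv bij_left_translation
      inv_inv_eq o_assoc)

lemma (in topological_loop) continuous_assoc_deviation:
  "continuous_on UNIV (assoc_deviation m a b)"
  unfolding assoc_deviation_def
  by (intro continuous_on_compose continuous_on_subset[OF continuous_left_translation]
      continuous_inv_left_translation) auto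

lemma (in topological_loop) continuous_inv_assoc_deviation:
  "continuous_on UNIV (inv (assoc_deviation m a b))"
  unfolding inv_assoc_deviation
  by (intro continuous_on_compose continuous_on_subset[OF continuous_left_translation]
      continuous_on_subset[OF continuous_inv_left_translation] continuous_inv_left_translation) auto

lemma (in loop) left_translation_comp:
  "left_translation m a \<circ> left_translation m b = assoc_deviation m a b \<circ> left_translation m (m a b)"
  using bij_left_translation[of "m a b"]
  by (simp add: assoc_deviation_def fun_eq_iff bij_is_inj)

section \<open>The modular cocycle identity\<close>

theorem proposition4p5:
  fixes m :: "'a::t2_space \<Rightarrow> 'a \<Rightarrow> 'a" and e :: 'a
    and \<mu> :: "'a measure"
    and lam :: "'a \<Rightarrow> 'a \<Rightarrow> real"
    and J :: "'a \<Rightarrow> 'a \<Rightarrow> 'a \<Rightarrow> real"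
  defines "L \<equiv> left_translation m"
    and "\<Phi> \<equiv> assoc_deviation m"
  assumes "topological_loop m e"
    and "locally_compact_space (euclidean :: 'a topology)"
    and "radon_measure \<mu>"
    and "\<And>a. quasi_invariant \<mu> (L a)"
    and "\<And>a. pushforward_derivative \<mu> (L a) (lam a)"
    and "\<And>a b. quasi_invariant \<mu> (\<Phi> a b)"
    and "\<And>a b. pushforward_derivative \<mu> (\<Phi> a b) (J a b)"
  shows "\<forall>a b.
    (AE x in \<mu>. lam a x * lam b (inv (L a) x) = J a b x * lam (m a b) (inv (\<Phi> a b) x)) \<and>
    (AE x in \<mu>. lam a (\<Phi> a b x) * lam b (inv (L a) (\<Phi> a b x)) = J a b (\<Phi> a b x) * lam (m a b) x)"
proof -
  interpret topological_loop m e by fact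
  have sets: "sets \<mu> = sets borel"
    using \<open>radon_measure \<mu>\<close> by (simp add: radon_measure_def)
  note borel = borel_measurable_continuous_onI
  have L: "inj (L a)" "L a \<in> borel_measurable borel" "inv (L a) \<in> borel_measurable borel" for a
    unfolding L_def
    by (simp_all add: bij_left_translation bij_is_inj borel continuous_left_translation
        continuous_inv_left_translation)
  have \<Phi>: "inj (\<Phi> a b)" "\<Phi> a b \<in> borel_measurable borel" "inv (\<Phi> a b) \<in> borel_measurable borel" for a b
    unfolding \<Phi>_def
    by (simp_all add: bij_assoc_deviation bij_is_inj borel continuous_assoc_deviation
        continuous_inv_assoc_deviation)
  have first: "AE x in \<mu>. lam a x * lam b (inv (L a) x) = J a b x * lam (m a b) (inv (\<Phi> a b) x)" for a b
  proof (rule pushforward_derivative_unique[OF \<open>radon_measure \<mu>\<close>])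
    show "pushforward_derivative \<mu> (L a \<circ> L b) (\<lambda>x. lam a x * lam b (inv (L a) x))"
      by (intro pushforward_derivative_comp sets L assms)
    have "pushforward_derivative \<mu> (\<Phi> a b \<circ> L (m a b)) (\<lambda>x. J a b x * lam (m a b) (inv (\<Phi> a b) x))"
      by (intro pushforward_derivative_comp sets L \<Phi> assms)
    then show "pushforward_derivative \<mu> (L a \<circ> L b) (\<lambda>x. J a b x * lam (m a b) (inv (\<Phi> a b) x))"
      by (simp add: L_def \<Phi>_def left_translation_comp)
  qed
  moreover have "AE x in \<mu>. lam a (\<Phi> a b x) * lam b (inv (L a) (\<Phi> a b x)) = J a b (\<Phi> a b x) * lam (m a b) x"
    for a b
    using quasi_invariant_AE[OF sets \<Phi>(2) \<open>quasi_invariant \<mu> (\<Phi> a b)\<close> first[of a b]] \<Phi>(1)[of a b]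
    by simp
  ultimately show ?thesis by blast
qed

end
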